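(* Let $\rho$ be a symmetric probability measure on $\mathbb{R}$ with variance $\sigma^2>0$ and such that $\Lambda$ is finite in a neighborhood of $(0,0)$. Then the function $$(x,y)\in\Delta^*\longmapsto I(x,y)-\frac{x^2}{2y}$$ has a unique minimum at $(0,\sigma^2)$, where it is equal to $0$.
   Context: A probability measure $\rho$ on $\mathbb{R}$ is symmetric if $\rho(A)=\rho(-A)$ for every Borel set $A$. For $(u,v)\in\mathbb{R}^2$, $\Lambda(u,v)=\ln\int_{\mathbb{R}}e^{uz+vz^2}\,d\rho(z)\in\,]{-\infty},+\infty]$. For $(x,y)\in\mathbb{R}^2$, $I(x,y)=\sup_{(u,v)\in\mathbb{R}^2}\big(xu+yv-\Lambda(u,v)\big)\in[0,+\infty]$. $\Delta=\{(x,y)\in\mathbb{R}^2: x^2\le y\}$ and $\Delta^*=\Delta\setminus\{(0,0)\}$. *)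

theory Defs
  imports "HOL-Probability.Probability"
begin

definition symmetric_measure :: "real measure \<Rightarrow> bool" where
  "symmetric_measure \<rho> \<longleftrightarrow>
     (\<forall>A\<in>sets borel. emeasure \<rho> A = emeasure \<rho> (uminus ` A))"

definition ln_ennreal :: "ennreal \<Rightarrow> ereal" where
  "ln_ennreal t =
     (if t = 0 then - \<infinity> else if t = top then \<infinity> else ereal (ln (enn2real t)))"

text \<open>
  The integral is the Lebesgue integral with values in \<open>[0, \<infinity>]\<close>, so that a divergent
  integral yields the value \<open>\<infinity>\<close>. (The Bochner integral would be \<open>0\<close> there.)
\<close>

definition Lambda :: "real measure \<Rightarrow> real \<Rightarrow> real \<Rightarrow> ereal" where
  "Lambda \<rho> u v = ln_ennreal (\<integral>\<^sup>+ z. ennreal (exp (u * z + v * z\<^sup>2)) \<partial>\<rho>)"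

definition rate_function :: "real measure \<Rightarrow> real \<Rightarrow> real \<Rightarrow> ereal" where
  "rate_function \<rho> x y = (SUP (u, v)\<in>UNIV. ereal (x * u + y * v) - Lambda \<rho> u v)"

definition Delta :: "(real \<times> real) set" where
  "Delta = {(x, y). x\<^sup>2 \<le> y}"

definition Delta_star :: "(real \<times> real) set" where
  "Delta_star = Delta - {(0, 0)}"

end

theory Submission
  imports Defs
begin

text \<open>
  Write \<open>Z\<close> for a random variable with law \<open>\<rho>\<close>. Every pair \<open>(u, v)\<close> gives the lower bound
  \<open>x u + y v - \<Lambda>(u, v)\<close> for the rate function at \<open>(x, y)\<close>, so strict positivity of
  \<open>I(x, y) - x\<^sup>2 / (2 y)\<close> only needs one good pair at each point. All points of \<open>\<Delta>\<^sup>*\<close>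
  have \<open>y > 0\<close>, and two cases arise.

  If \<open>x \<noteq> 0\<close>, take \<open>u = x / y\<close> and \<open>v = - u\<^sup>2 / 2\<close>. Then \<open>x u + y v\<close> is exactly
  \<open>x\<^sup>2 / (2 y)\<close>, and it remains to see that \<open>\<Lambda>(u, - u\<^sup>2 / 2) < 0\<close>. By symmetry of \<open>\<rho>\<close> the
  exponential \<open>exp (u Z)\<close> may be replaced by \<open>cosh (u Z)\<close> under the expectation, and
  \<open>cosh t < exp (t\<^sup>2 / 2)\<close> for \<open>t \<noteq> 0\<close>
  (\<open>nn_integral_gaussian_tilt_less_1\<close>, \<open>rate_function_greater_gaussian\<close>).

  If \<open>x = 0\<close> and \<open>y \<noteq> \<sigma>\<^sup>2\<close>, take \<open>u = 0\<close>. The function \<open>v \<mapsto> E exp (v (Z\<^sup>2 - y))\<close> equals \<open>1\<close>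
  at \<open>0\<close> and has there the nonzero derivative \<open>\<sigma>\<^sup>2 - y\<close>, so it drops below \<open>1\<close> for some
  small \<open>v\<close> of the opposite sign (\<open>rate_function_axis_pos\<close>). The finiteness of \<open>\<Lambda>\<close> near
  the origin enters here, as the integrability of \<open>exp (\<delta> Z\<^sup>2)\<close> for some \<open>\<delta> > 0\<close>.

  At \<open>(0, \<sigma>\<^sup>2) = (E Z, E Z\<^sup>2)\<close> the value is \<open>0\<close>, by Jensen's inequality
  \<open>\<Lambda>(u, v) \<ge> u E Z + v E Z\<^sup>2\<close> (\<open>rate_function_mean_eq_0\<close>).
\<close>

section \<open>Elementary inequalities for the exponential function\<close>

text \<open>
  The quotient \<open>cosh t / exp (t\<^sup>2 / 2)\<close> decreases on the positive half-line, because its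
  derivative has the sign of \<open>sinh t - t cosh t\<close>, which in turn decreases from \<open>0\<close>.
\<close>
lemma cosh_less_exp_half_square:
  fixes x :: real
  assumes "x \<noteq> 0"
  shows "cosh x < exp (x\<^sup>2 / 2)"
proof -
  have sinh_less: "sinh t < t * cosh t" if "t > 0" for t :: real
  proof -
    have "sinh t - t * cosh t < sinh 0 - 0 * cosh (0::real)"
    proof (rule DERIV_neg_imp_decreasing_open[OF that])
      fix s :: real assume "0 < s" "s < t"
      have "((\<lambda>r. sinh r - r * cosh r) has_real_derivative - (s * sinh s)) (at s)"
        by (auto intro!: derivative_eq_intros)
      moreover have "- (s * sinh s) < 0"
        using \<open>0 < s\<close> by simp
      ultimately show "\<exists>d. ((\<lambda>r. sinh r - r * cosh r) has_real_derivative d) (at s) \<and> d < 0"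
        by blast
    qed (intro continuous_intros)
    then show ?thesis by simp
  qed
  have pos: "cosh t < exp (t\<^sup>2 / 2)" if "t > 0" for t :: real
  proof -
    have "cosh t * exp (- t\<^sup>2 / 2) < cosh 0 * exp (- 0\<^sup>2 / (2::real))"
    proof (rule DERIV_neg_imp_decreasing_open[OF that])
      fix s :: real assume "0 < s" "s < t"
      have "((\<lambda>r. cosh r * exp (- r\<^sup>2 / 2)) has_real_derivative
          (sinh s - s * cosh s) * exp (- s\<^sup>2 / 2)) (at s)"
        by (auto intro!: derivative_eq_intros simp: field_simps)
      moreover have "(sinh s - s * cosh s) * exp (- s\<^sup>2 / 2) < 0"
        using sinh_less[OF \<open>0 < s\<close>] by (simp add: mult_less_0_iff)
      ultimately show "\<exists>d. ((\<lambda>r. cosh r * exp (- r\<^sup>2 / 2)) has_real_derivative d) (at s) \<and> d < 0"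
        by blast
    qed (intro continuous_intros, simp)
    then show ?thesis by (simp add: exp_minus field_simps)
  qed
  show ?thesis
    using pos[of x] pos[of "- x"] assms by (cases "x > 0") auto
qed

lemma exp_le_quadratic:
  fixes t :: real
  shows "exp t \<le> 1 + t + t\<^sup>2 / 2 * exp \<bar>t\<bar>"
proof -
  obtain s where s: "\<bar>s\<bar> \<le> \<bar>t\<bar>" "exp t = 1 + t + exp s / 2 * t\<^sup>2"
    using Maclaurin_exp_le[of t 2] by (auto simp: eval_nat_numeral)
  have "exp s * t\<^sup>2 \<le> exp \<bar>t\<bar> * t\<^sup>2"
    using s(1) by (intro mult_right_mono) auto
  then show ?thesis
    using s(2) by (simp add: mult.commute)
qed

text \<open>
  A second-order expansion in \<open>v\<close>, uniform in \<open>w\<close>: the factor of \<open>v\<^sup>2\<close> involves only the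
  bound \<open>\<delta>\<close> on \<open>v\<close>. Integrating over \<open>w\<close> therefore gives a first-order expansion of an
  exponential moment without differentiation under the integral. The quadratic factor
  \<open>w\<^sup>2\<close> of the Taylor remainder is absorbed by doubling the exponent.
\<close>
lemma exp_mult_le_affine_quadratic:
  fixes v w \<delta> :: real
  assumes "0 < \<delta>" "\<bar>v\<bar> \<le> \<delta>"
  shows "exp (v * w) \<le> 1 + v * w + v\<^sup>2 * (exp (2 * \<delta> * \<bar>w\<bar>) / \<delta>\<^sup>2)"
proof -
  have "(\<delta> * \<bar>w\<bar>)\<^sup>2 / 2 \<le> exp (\<delta> * \<bar>w\<bar>)"
  proof -
    have "0 \<le> \<delta> * \<bar>w\<bar>"
      using assms(1) by simp
    then show ?thesis
      using exp_lower_Taylor_quadratic[of "\<delta> * \<bar>w\<bar>"] by linarith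
  qed
  then have w: "w\<^sup>2 / 2 \<le> exp (\<delta> * \<bar>w\<bar>) / \<delta>\<^sup>2"
    using assms(1) by (simp add: field_simps power_mult_distrib)
  have "\<bar>v * w\<bar> \<le> \<delta> * \<bar>w\<bar>"
    using assms(2) by (simp add: abs_mult mult_right_mono)
  then have e: "exp \<bar>v * w\<bar> \<le> exp (\<delta> * \<bar>w\<bar>)"
    by simp
  have "(v * w)\<^sup>2 / 2 * exp \<bar>v * w\<bar> = v\<^sup>2 * (w\<^sup>2 / 2 * exp \<bar>v * w\<bar>)"
    by (simp add: power_mult_distrib)
  also have "\<dots> \<le> v\<^sup>2 * (exp (\<delta> * \<bar>w\<bar>) / \<delta>\<^sup>2 * exp (\<delta> * \<bar>w\<bar>))"
    using w e by (intro mult_left_mono mult_mono) auto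
  also have "\<dots> = v\<^sup>2 * (exp (2 * \<delta> * \<bar>w\<bar>) / \<delta>\<^sup>2)"
    by (simp add: exp_add[symmetric])
  finally show ?thesis
    using exp_le_quadratic[of "v * w"] by linarith
qed

section \<open>The rate function as a Legendre transform\<close>

lemma ln_ennreal_less_iff: "ln_ennreal t < ereal a \<longleftrightarrow> t < ennreal (exp a)"
proof (cases t)
  case (real r)
  then show ?thesis
    using ln_less_cancel_iff[of r "exp a"]
    by (cases "r = 0") (simp_all add: ln_ennreal_def ennreal_less_iff)
next
  case top
  then show ?thesis by (simp add: ln_ennreal_def)
qed

text \<open>
  The next two rules trade the extended-real logarithm for comparisons of nonnegative
  integrals with exponentials, which also covers divergent integrals.
\<close>
lemma less_rate_functionI:
  assumes "(\<integral>\<^sup>+ z. ennreal (exp (u * z + v * z\<^sup>2)) \<partial>\<rho>) < ennreal (exp (x * u + y * v - c))"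
  shows "ereal c < rate_function \<rho> x y"
proof -
  have "Lambda \<rho> u v < ereal (x * u + y * v - c)"
    using assms by (simp add: Lambda_def ln_ennreal_less_iff)
  then have "ereal c < ereal (x * u + y * v) - Lambda \<rho> u v"
    by (cases "Lambda \<rho> u v") auto
  also have "\<dots> \<le> rate_function \<rho> x y"
    unfolding rate_function_def by (rule SUP_upper2[of "(u, v)"]) auto
  finally show ?thesis .
qed

lemma rate_function_leI:
  assumes "\<And>u v. ennreal (exp (x * u + y * v - c))
      \<le> (\<integral>\<^sup>+ z. ennreal (exp (u * z + v * z\<^sup>2)) \<partial>\<rho>)"
  shows "rate_function \<rho> x y \<le> ereal c"
  unfolding rate_function_def
proof (rule SUP_least, clarify)
  fix u v
  have "\<not> Lambda \<rho> u v < ereal (x * u + y * v - c)"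
    using assms[of u v] by (simp add: Lambda_def ln_ennreal_less_iff)
  then show "ereal (x * u + y * v) - Lambda \<rho> u v \<le> ereal c"
    by (cases "Lambda \<rho> u v") auto
qed

text \<open>
  Jensen's inequality for \<open>exp\<close>, with the right-hand side in \<open>[0, \<infinity>]\<close> so that \<open>exp \<circ> f\<close> may
  fail to be integrable. It follows from the tangent line of \<open>exp\<close> at the mean.
\<close>
lemma (in prob_space) exp_expectation_le_nn_integral_exp:
  fixes f :: "'a \<Rightarrow> real"
  assumes f: "integrable M f"
  shows "ennreal (exp (expectation f)) \<le> (\<integral>\<^sup>+ x. ennreal (exp (f x)) \<partial>M)"
proof (cases "(\<integral>\<^sup>+ x. ennreal (exp (f x)) \<partial>M) = \<infinity>")
  case False
  have [measurable]: "f \<in> borel_measurable M"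
    using f by simp
  have exp_f: "integrable M (\<lambda>x. exp (f x))"
    using False by (intro integrableI_nonneg) (auto simp: top.not_eq_extremum)
  have "exp (expectation f) \<le> expectation (\<lambda>x. exp (f x))"
  proof -
    have "expectation (\<lambda>x. 1 + (f x - expectation f)) \<le> expectation (\<lambda>x. exp (f x - expectation f))"
      using f exp_f
      by (intro integral_mono exp_ge_add_one_self) (auto simp: exp_diff)
    then show ?thesis
      using f by (simp add: prob_space exp_diff field_simps)
  qed
  then show ?thesis
    using exp_f by (simp add: nn_integral_eq_integral)
qed simp

section \<open>Symmetric distributions\<close>

lemma symmetric_measure_distr_uminus:
  assumes "symmetric_measure \<rho>" and [simp, measurable_cong]: "sets \<rho> = sets borel"
  shows "distr \<rho> \<rho> uminus = \<rho>"
proof (rule measure_eqI)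
  fix A assume "A \<in> sets (distr \<rho> \<rho> uminus)"
  then have A: "A \<in> sets \<rho>" by simp
  have sp: "space \<rho> = UNIV"
    using sets_eq_imp_space_eq[OF assms(2)] by simp
  have "emeasure (distr \<rho> \<rho> uminus) A = emeasure \<rho> (uminus -` A)"
    using A by (simp add: emeasure_distr sp)
  also have "uminus -` A = uminus ` A"
    using minus_image_eq_vimage[of A] by simp
  also have "emeasure \<rho> (uminus ` A) = emeasure \<rho> A"
    using assms A by (simp add: symmetric_measure_def)
  finally show "emeasure (distr \<rho> \<rho> uminus) A = emeasure \<rho> A" .
qed simp

locale symmetric_distribution = real_distribution +
  assumes symmetric: "symmetric_measure M"
begin

lemma integrable_reflect:
  fixes f :: "real \<Rightarrow> real"
  assumes "integrable M f"
  shows "integrable M (\<lambda>z. f (- z))"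
  using assms integrable_distr[of uminus M M f]
    symmetric_measure_distr_uminus[OF symmetric events_eq_borel] by simp

lemma expectation_reflect:
  fixes f :: "real \<Rightarrow> real"
  assumes [measurable]: "f \<in> borel_measurable M"
  shows "expectation (\<lambda>z. f (- z)) = expectation f"
proof -
  have "expectation f = integral\<^sup>L (distr M M uminus) f"
    by (simp add: symmetric_measure_distr_uminus[OF symmetric events_eq_borel])
  also have "\<dots> = expectation (\<lambda>z. f (- z))"
    by (rule integral_distr) measurable
  finally show ?thesis ..
qed

lemma expectation_id_eq_0: "expectation (\<lambda>z. z) = 0"
  using expectation_reflect[of "\<lambda>z. z"] by simp

text \<open>
  Averaging the integrand over \<open>z\<close> and \<open>- z\<close> turns \<open>exp (u z)\<close> into \<open>cosh (u z)\<close>. The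
  averaged integrand \<open>cosh (u z) exp (- (u z)\<^sup>2 / 2)\<close> is below \<open>1\<close> except at \<open>z = 0\<close>.
\<close>
lemma nn_integral_gaussian_tilt_less_1:
  assumes "\<not> (AE z in M. z = 0)" "u \<noteq> 0"
  shows "(\<integral>\<^sup>+ z. ennreal (exp (u * z + - (u\<^sup>2 / 2) * z\<^sup>2)) \<partial>M) < 1"
proof -
  define f where "f z = exp (u * z + - (u\<^sup>2 / 2) * z\<^sup>2)" for z
  define g where "g z = cosh (u * z) * exp (- ((u * z)\<^sup>2 / 2))" for z
  have f_measurable [measurable]: "f \<in> borel_measurable M"
    unfolding f_def by measurable
  \<comment> \<open>The exponent is a concave quadratic in \<open>u z\<close>, so \<open>f\<close> is bounded and hence integrable.\<close>
  have f_bound: "f z \<le> exp (1 / 2)" for z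
  proof -
    have "u * z + - (u\<^sup>2 / 2) * z\<^sup>2 = 1 / 2 - (u * z - 1)\<^sup>2 / 2"
      by (simp add: power2_eq_square field_simps)
    then show ?thesis
      by (simp add: f_def)
  qed
  have f: "integrable M f"
    using f_bound by (intro integrable_const_bound[of _ "exp (1/2)"]) (auto simp: f_def)
  have g_eq: "g = (\<lambda>z. (f z + f (- z)) / 2)"
    by (simp add: fun_eq_iff f_def g_def cosh_field_def power_mult_distrib field_simps
        flip: exp_add)
  have g: "integrable M g"
    using f integrable_reflect[OF f] by (simp add: g_eq)
  have f_eq_g: "expectation f = expectation g"
    using f integrable_reflect[OF f] expectation_reflect[of f] by (simp add: g_eq)
  have g_less: "g z < 1" if "z \<noteq> 0" for z
    using cosh_less_exp_half_square[of "u * z"] that \<open>u \<noteq> 0\<close>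
    by (simp add: g_def exp_minus field_simps)
  have g_0: "g 0 = 1"
    by (simp add: g_def)
  have "expectation g < expectation (\<lambda>_. 1)"
  proof (rule integral_less_AE[OF g])
    show "emeasure M (space M - {0}) \<noteq> 0"
      using assms(1) by (subst (asm) AE_iff_measurable[of "space M - {0}"]) auto
    show "AE z in M. g z \<le> 1"
      using g_less g_0 by (intro AE_I2) (metis less_imp_le order_refl)
    show "AE z in M. z \<in> space M - {0} \<longrightarrow> g z \<noteq> 1"
      using g_less by (intro AE_I2) fastforce
  qed auto
  then have "expectation f < 1"
    by (simp add: f_eq_g prob_space[simplified])
  moreover have "(\<integral>\<^sup>+ z. ennreal (f z) \<partial>M) = ennreal (expectation f)"
    by (intro nn_integral_eq_integral f AE_I2) (simp add: f_def)
  ultimately show ?thesis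
    by (simp add: f_def ennreal_less_one_iff)
qed

text \<open>
  The parameters \<open>u = x / y\<close> and \<open>v = - u\<^sup>2 / 2\<close> are chosen on the parabola where the previous
  bound applies, with \<open>u\<close> maximising \<open>x u - y u\<^sup>2 / 2\<close>; the maximum is \<open>x\<^sup>2 / (2 y)\<close>.
\<close>
lemma rate_function_greater_gaussian:
  assumes "\<not> (AE z in M. z = 0)" "x \<noteq> 0" "y > 0"
  shows "ereal (x\<^sup>2 / (2 * y)) < rate_function M x y"
proof (rule less_rate_functionI)
  have "x * (x / y) + y * - ((x / y)\<^sup>2 / 2) - x\<^sup>2 / (2 * y) = 0"
    using \<open>y > 0\<close> by (simp add: field_simps power2_eq_square)
  then show "(\<integral>\<^sup>+ z. ennreal (exp (x / y * z + - ((x / y)\<^sup>2 / 2) * z\<^sup>2)) \<partial>M)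
      < ennreal (exp (x * (x / y) + y * - ((x / y)\<^sup>2 / 2) - x\<^sup>2 / (2 * y)))"
    using nn_integral_gaussian_tilt_less_1[OF assms(1), of "x / y"] assms by simp
qed

end

section \<open>Distributions with a Gaussian exponential moment\<close>

context real_distribution
begin

lemma gaussian_moment_of_finite_Lambda:
  assumes "\<forall>\<^sub>F (u, v) in nhds (0, 0). \<bar>Lambda M u v\<bar> \<noteq> \<infinity>"
  shows "\<exists>\<delta>>0. integrable M (\<lambda>z. exp (\<delta> * z\<^sup>2))"
proof -
  have lim: "((\<lambda>v. (0, v)) \<longlongrightarrow> (0, 0::real)) (nhds (0::real))"
    by (intro tendsto_Pair tendsto_const filterlim_ident)
  have "\<forall>\<^sub>F v in nhds 0. \<bar>Lambda M 0 v\<bar> \<noteq> \<infinity>"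
    using eventually_compose_filterlim[OF assms lim] by simp
  then obtain e where e: "e > 0" "\<And>v. dist v 0 < e \<Longrightarrow> \<bar>Lambda M 0 v\<bar> \<noteq> \<infinity>"
    unfolding eventually_nhds_metric by blast
  then have "\<bar>Lambda M 0 (e / 2)\<bar> \<noteq> \<infinity>"
    by simp
  then have "(\<integral>\<^sup>+ z. ennreal (exp (e / 2 * z\<^sup>2)) \<partial>M) < \<infinity>"
    by (auto simp: Lambda_def ln_ennreal_def top.not_eq_extremum split: if_splits)
  then have "integrable M (\<lambda>z. exp (e / 2 * z\<^sup>2))"
    by (intro integrableI_nonneg) auto
  then show ?thesis
    using \<open>e > 0\<close> by (intro exI[of _ "e / 2"]) auto
qed

lemma integrable_square_of_gaussian_moment:
  assumes "\<delta> > 0" "integrable M (\<lambda>z. exp (\<delta> * z\<^sup>2))"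
  shows "integrable M (\<lambda>z. z\<^sup>2)"
proof (rule Bochner_Integration.integrable_bound)
  show "integrable M (\<lambda>z. exp (\<delta> * z\<^sup>2) / \<delta>)"
    using assms by simp
  have "\<delta> * z\<^sup>2 \<le> exp (\<delta> * z\<^sup>2)" for z
    using exp_ge_add_one_self[of "\<delta> * z\<^sup>2"] by linarith
  then show "AE z in M. norm (z\<^sup>2) \<le> norm (exp (\<delta> * z\<^sup>2) / \<delta>)"
    using assms(1) by (intro AE_I2) (simp add: field_simps)
qed simp

text \<open>
  The one-variable function \<open>v \<mapsto> E exp (v (Z\<^sup>2 - y))\<close> is at most \<open>1 + v d + v\<^sup>2 C\<close> near \<open>0\<close>,
  where \<open>d = E Z\<^sup>2 - y \<noteq> 0\<close>. Hence it is below \<open>1\<close> at \<open>v = - \<eta> d\<close> for small \<open>\<eta> > 0\<close>.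
\<close>
lemma rate_function_axis_pos:
  assumes "\<delta> > 0" and mgf: "integrable M (\<lambda>z. exp (\<delta> * z\<^sup>2))"
    and "y \<ge> 0" "y \<noteq> expectation (\<lambda>z. z\<^sup>2)"
  shows "0 < rate_function M 0 y"
proof -
  define d where "d = expectation (\<lambda>z. z\<^sup>2) - y"
  define C where "C = exp (\<delta> * y) * expectation (\<lambda>z. exp (\<delta> * z\<^sup>2)) / (\<delta> / 2)\<^sup>2"
  \<comment> \<open>The first bound on \<open>\<eta>\<close> keeps \<open>v\<close> in the range of the expansion, the second makes
     the quadratic term smaller than the linear gain.\<close>
  define \<eta> where "\<eta> = min (\<delta> / 2 / \<bar>d\<bar>) (1 / (C + 1))"
  define v where "v = - \<eta> * d"
  have d: "d \<noteq> 0"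
    using assms by (simp add: d_def)
  have C: "C \<ge> 0"
    by (simp add: C_def)
  have \<eta>: "\<eta> > 0" "\<eta> * \<bar>d\<bar> \<le> \<delta> / 2" "\<eta> * C < 1"
  proof -
    show "\<eta> > 0"
      using d C \<open>\<delta> > 0\<close> by (simp add: \<eta>_def)
    have "\<eta> \<le> \<delta> / 2 / \<bar>d\<bar>" "\<eta> \<le> 1 / (C + 1)"
      by (simp_all add: \<eta>_def)
    then show "\<eta> * \<bar>d\<bar> \<le> \<delta> / 2"
      using d by (simp add: field_simps)
    have "\<eta> * (C + 1) \<le> 1"
      using \<open>\<eta> \<le> 1 / (C + 1)\<close> C by (simp add: field_simps)
    then show "\<eta> * C < 1"
      using \<open>\<eta> > 0\<close> by (simp add: field_simps)
  qed
  have v: "\<bar>v\<bar> \<le> \<delta> / 2"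
    using \<eta> by (simp add: v_def abs_mult)
  define b where
    "b = (\<lambda>z. 1 + v * (z\<^sup>2 - y) + v\<^sup>2 * (exp (\<delta> * y) * exp (\<delta> * z\<^sup>2) / (\<delta> / 2)\<^sup>2))"
  have exp_le_b: "exp (v * (z\<^sup>2 - y)) \<le> b z" for z
  proof -
    have "\<bar>z\<^sup>2 - y\<bar> \<le> y + z\<^sup>2"
      using \<open>y \<ge> 0\<close> zero_le_power2[of z] by linarith
    then have "\<delta> * \<bar>z\<^sup>2 - y\<bar> \<le> \<delta> * (y + z\<^sup>2)"
      using \<open>\<delta> > 0\<close> by (intro mult_left_mono) auto
    then have "exp (\<delta> * \<bar>z\<^sup>2 - y\<bar>) \<le> exp (\<delta> * y) * exp (\<delta> * z\<^sup>2)"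
      by (simp add: distrib_left flip: exp_add)
    then have "v\<^sup>2 * (exp (\<delta> * \<bar>z\<^sup>2 - y\<bar>) / (\<delta> / 2)\<^sup>2)
        \<le> v\<^sup>2 * (exp (\<delta> * y) * exp (\<delta> * z\<^sup>2) / (\<delta> / 2)\<^sup>2)"
      by (intro mult_left_mono divide_right_mono) auto
    then show ?thesis
      using exp_mult_le_affine_quadratic[of "\<delta> / 2" v "z\<^sup>2 - y"] v \<open>\<delta> > 0\<close> by (simp add: b_def)
  qed
  have sq: "integrable M (\<lambda>z. z\<^sup>2)"
    by (rule integrable_square_of_gaussian_moment[OF \<open>\<delta> > 0\<close> mgf])
  have b: "integrable M b"
    unfolding b_def using sq mgf by (intro Bochner_Integration.integrable_add integrable_mult_right
        Bochner_Integration.integrable_diff integrable_divide) auto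
  have "expectation b = 1 + v * d + v\<^sup>2 * C"
    using sq mgf by (simp add: b_def d_def C_def prob_space[simplified])
  also have "\<dots> = 1 - \<eta> * d\<^sup>2 * (1 - \<eta> * C)"
    by (simp add: v_def algebra_simps power2_eq_square)
  also have "\<dots> < 1"
    using \<eta> d by simp
  finally have b_less: "expectation b < 1" .
  have "(\<integral>\<^sup>+ z. ennreal (exp (0 * z + v * z\<^sup>2)) \<partial>M)
      \<le> (\<integral>\<^sup>+ z. ennreal (exp (y * v)) * ennreal (b z) \<partial>M)"
  proof (rule nn_integral_mono)
    fix z
    have "exp (0 * z + v * z\<^sup>2) = exp (y * v) * exp (v * (z\<^sup>2 - y))"
      by (simp add: algebra_simps flip: exp_add)
    also have "\<dots> \<le> exp (y * v) * b z"
      using exp_le_b by simp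
    finally show "ennreal (exp (0 * z + v * z\<^sup>2)) \<le> ennreal (exp (y * v)) * ennreal (b z)"
      by (simp add: ennreal_leI flip: ennreal_mult')
  qed
  also have "\<dots> = ennreal (exp (y * v)) * (\<integral>\<^sup>+ z. ennreal (b z) \<partial>M)"
    using b by (intro nn_integral_cmult) auto
  also have "(\<integral>\<^sup>+ z. ennreal (b z) \<partial>M) = ennreal (expectation b)"
    using b by (intro nn_integral_eq_integral AE_I2) (auto intro: order_trans[OF exp_ge_zero exp_le_b])
  also have "ennreal (exp (y * v)) * ennreal (expectation b) = ennreal (exp (y * v) * expectation b)"
    by (simp add: ennreal_mult')
  also have "\<dots> < ennreal (exp (0 * 0 + y * v - 0))"
    using b_less by (simp add: ennreal_less_iff ennreal_lessI)
  finally have "ereal 0 < rate_function M 0 y"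
    by (rule less_rate_functionI)
  then show ?thesis
    by (simp add: zero_ereal_def)
qed

text \<open>
  Jensen's inequality bounds \<open>\<Lambda>(u, v)\<close> below by the linear function \<open>u E Z + v E Z\<^sup>2\<close>, with
  equality at the origin; so the Legendre transform vanishes at the slope of that function.
\<close>
lemma rate_function_mean_eq_0:
  assumes "integrable M (\<lambda>z. z\<^sup>2)"
  shows "rate_function M (expectation (\<lambda>z. z)) (expectation (\<lambda>z. z\<^sup>2)) = 0"
proof (rule antisym)
  have id: "integrable M (\<lambda>z. z)"
    using square_integrable_imp_integrable[of "\<lambda>z. z"] assms by simp
  have "rate_function M (expectation (\<lambda>z. z)) (expectation (\<lambda>z. z\<^sup>2)) \<le> ereal 0"
  proof (rule rate_function_leI)
    fix u v
    show "ennreal (exp (expectation (\<lambda>z. z) * u + expectation (\<lambda>z. z\<^sup>2) * v - 0))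
        \<le> (\<integral>\<^sup>+ z. ennreal (exp (u * z + v * z\<^sup>2)) \<partial>M)"
      using exp_expectation_le_nn_integral_exp[of "\<lambda>z. u * z + v * z\<^sup>2"] id assms
      by (simp add: mult.commute)
  qed
  then show "rate_function M (expectation (\<lambda>z. z)) (expectation (\<lambda>z. z\<^sup>2)) \<le> 0"
    by (simp add: zero_ereal_def)
  have "Lambda M 0 0 = 0"
    by (simp add: Lambda_def ln_ennreal_def emeasure_space_1[simplified])
  then show "0 \<le> rate_function M (expectation (\<lambda>z. z)) (expectation (\<lambda>z. z\<^sup>2))"
    unfolding rate_function_def by (intro SUP_upper2[of "(0, 0)"]) auto
qed

end

section \<open>The minimum over the punctured region above the parabola\<close>

theorem proposition13:
  fixes \<rho> :: "real measure" and \<sigma> :: real and F :: "real \<times> real \<Rightarrow> ereal"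
  defines "F \<equiv> (\<lambda>(x, y). rate_function \<rho> x y - ereal (x\<^sup>2 / (2 * y)))"
  assumes "real_distribution \<rho>"
    and "symmetric_measure \<rho>"
    and "prob_space.variance \<rho> (\<lambda>z. z) = \<sigma>\<^sup>2"
    and "\<sigma>\<^sup>2 > 0"
    and "\<forall>\<^sub>F (u, v) in nhds (0, 0). \<bar>Lambda \<rho> u v\<bar> \<noteq> \<infinity>"
  shows "(\<forall>p. is_arg_min F (\<lambda>q. q \<in> Delta_star) p \<longleftrightarrow> p = (0, \<sigma>\<^sup>2)) \<and> F (0, \<sigma>\<^sup>2) = 0"
proof -
  interpret symmetric_distribution \<rho>
    using assms by (simp add: symmetric_distribution_def symmetric_distribution_axioms_def)
  obtain \<delta> where \<delta>: "\<delta> > 0" "integrable \<rho> (\<lambda>z. exp (\<delta> * z\<^sup>2))"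
    using gaussian_moment_of_finite_Lambda[OF assms(6)] by blast
  have second_moment: "expectation (\<lambda>z. z\<^sup>2) = \<sigma>\<^sup>2"
    using assms(4) by (simp add: expectation_id_eq_0)
  have nondegenerate: "\<not> (AE z in \<rho>. z = 0)"
  proof
    assume "AE z in \<rho>. z = 0"
    then have "expectation (\<lambda>z. z\<^sup>2) = expectation (\<lambda>_. 0)"
      by (intro integral_cong_AE) auto
    then show False
      using second_moment \<open>\<sigma>\<^sup>2 > 0\<close> by simp
  qed
  have F_min: "F (0, \<sigma>\<^sup>2) = 0"
    using rate_function_mean_eq_0[OF integrable_square_of_gaussian_moment[OF \<delta>]]
    by (simp add: F_def second_moment expectation_id_eq_0)
  have F_pos: "0 < F p" if "p \<in> Delta_star" "p \<noteq> (0, \<sigma>\<^sup>2)" for p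
  proof -
    obtain x y where p: "p = (x, y)" by fastforce
    have "x\<^sup>2 \<le> y" "(x, y) \<noteq> (0, 0)"
      using that(1) by (auto simp: p Delta_star_def Delta_def)
    then have y: "y > 0"
      by (cases "x = 0") (auto intro: less_le_trans[of 0 "x\<^sup>2"])
    have "ereal (x\<^sup>2 / (2 * y)) < rate_function \<rho> x y"
    proof (cases "x = 0")
      case True
      then have "y \<noteq> expectation (\<lambda>z. z\<^sup>2)"
        using that(2) by (simp add: p second_moment)
      then show ?thesis
        using rate_function_axis_pos[OF \<delta>, of y] y True by (simp add: zero_ereal_def)
    qed (use rate_function_greater_gaussian[OF nondegenerate] y in simp)
    then show ?thesis
      by (cases "rate_function \<rho> x y") (auto simp: F_def p)
  qed
  have min_mem: "(0, \<sigma>\<^sup>2) \<in> Delta_star"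
    using \<open>\<sigma>\<^sup>2 > 0\<close> by (simp add: Delta_star_def Delta_def)
  have "is_arg_min F (\<lambda>q. q \<in> Delta_star) p \<longleftrightarrow> p = (0, \<sigma>\<^sup>2)" for p
  proof
    assume "is_arg_min F (\<lambda>q. q \<in> Delta_star) p"
    then have "p \<in> Delta_star" "\<not> F (0, \<sigma>\<^sup>2) < F p"
      using min_mem by (auto simp: is_arg_min_def)
    then show "p = (0, \<sigma>\<^sup>2)"
      using F_pos[of p] F_min by metis
  next
    assume "p = (0, \<sigma>\<^sup>2)"
    then show "is_arg_min F (\<lambda>q. q \<in> Delta_star) p"
      using min_mem F_min F_pos by (auto simp: is_arg_min_def) (metis less_asym less_irrefl)
  qed
  then show ?thesis
    using F_min by blast
qed

end
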